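(* Let $a>-1$ and let $c,d\in\mathbb{R}$ be not both zero. Let $0<j_1(a,c,d)<j_2(a,c,d)<\cdots$ be the positive zeros of $x\mapsto cJ_a(x)+dJ_{a+1}(x)$. Then $$\lim_{k\to\infty}\bigl(j_{k+1}(a,c,d)-j_k(a,c,d)\bigr)=\pi.$$
   Context: $J_a$ denotes the Bessel function of the first kind of order $a$. For $a>-1$ and real $c,d$ not both zero, the function $cJ_a(x)+dJ_{a+1}(x)$ has infinitely many positive zeros, which are listed in increasing order as $j_k(a,c,d)$, $k\ge1$. *)

theory Defs
  imports "HOL-Analysis.Analysis"
begin

text \<open>
  Bessel function of the first kind of real order, by its standard series. The reciprocal Gamma
  function makes the terms at the poles of Gamma vanish. Because of \<open>powr\<close>, the value is
  the intended one for \<open>x > 0\<close> only.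
\<close>

definition bessel_J :: "real \<Rightarrow> real \<Rightarrow> real" where
  "bessel_J a x =
     (\<Sum>m. (-1) ^ m * rGamma (real m + a + 1) / fact m * (x / 2) powr (2 * real m + a))"

text \<open>
  The positive zeros in increasing order are \<open>bessel_comb_zero a c d k\<close> for \<open>k \<ge> 1\<close>; index \<open>0\<close>
  holds the starting value \<open>0\<close>, which is not counted as a zero.
\<close>

primrec bessel_comb_zero :: "real \<Rightarrow> real \<Rightarrow> real \<Rightarrow> nat \<Rightarrow> real" where
  "bessel_comb_zero a c d 0 = 0"
| "bessel_comb_zero a c d (Suc k) =
     (LEAST x. bessel_comb_zero a c d k < x \<and> c * bessel_J a x + d * bessel_J (a + 1) x = 0)"

text \<open>Any increasing listing of all the positive zeros agrees with \<^const>\<open>bessel_comb_zero\<close>.\<close>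

lemma bessel_comb_zero_eqI:
  assumes mono: "strict_mono j"
    and range: "range j = {x. 0 < x \<and> c * bessel_J a x + d * bessel_J (a + 1) x = 0}"
  shows "bessel_comb_zero a c d (Suc k) = j k"
proof (induction k)
  case 0
  have "j 0 \<le> y" if "0 < y" "c * bessel_J a y + d * bessel_J (a + 1) y = 0" for y
  proof -
    from that range obtain n where "y = j n" by blast
    then show ?thesis using mono by (simp add: strict_mono_less_eq)
  qed
  moreover have "0 < j 0 \<and> c * bessel_J a (j 0) + d * bessel_J (a + 1) (j 0) = 0"
    using range by blast
  ultimately show ?case by (auto intro!: Least_equality)
next
  case (Suc k)
  have "j (Suc k) \<le> y" if "j k < y" "c * bessel_J a y + d * bessel_J (a + 1) y = 0" for y
  proof -
    have "0 < j k" using range by blast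
    with that range obtain n where "y = j n" by (smt (verit) imageE mem_Collect_eq)
    with that mono show ?thesis by (simp add: strict_mono_less_eq strict_mono_less)
  qed
  moreover have "j k < j (Suc k)" using mono by (simp add: strict_mono_less)
  moreover have "c * bessel_J a (j (Suc k)) + d * bessel_J (a + 1) (j (Suc k)) = 0"
    using range by blast
  ultimately have "(LEAST x. j k < x \<and> c * bessel_J a x + d * bessel_J (a + 1) x = 0) = j (Suc k)"
    by (intro Least_equality) auto
  then show ?case using Suc.IH by (subst bessel_comb_zero.simps(2)) (simp only:)
qed

end

theory Submission
  imports Defs
begin

text \<open>
  By the recurrences \<open>u' = (a / x) u - v\<close> and \<open>v' = u - ((a + 1) / x) v\<close> for \<open>u = J\<^sub>a\<close> and
  \<open>v = J\<^sub>a\<^sub>+\<^sub>1\<close>, the vector \<open>(u, v)\<close> never vanishes on \<open>x > 0\<close>, and its polar angle \<open>\<theta>\<close> satisfies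
  \<open>\<theta>' = 1 - ((2a + 1) / x) u v / (u\<^sup>2 + v\<^sup>2)\<close>, which tends to \<open>1\<close>. The zeros of \<open>c u + d v\<close> are the points
  where \<open>\<theta>\<close> lies in a fixed coset of \<open>\<pi>\<int>\<close>; for large \<open>x\<close> consecutive zeros therefore correspond to
  an increment of \<open>\<theta>\<close> by exactly \<open>\<pi>\<close>, and the mean value theorem gives the limit of the gaps.
\<close>

subsection \<open>Bessel functions\<close>

definition bessel_coeff :: "real \<Rightarrow> nat \<Rightarrow> real" where
  "bessel_coeff a m = (-1) ^ m * rGamma (real m + a + 1) / fact m"

text \<open>The Bessel-Clifford function of order \<open>a\<close> at \<open>-t\<close>. It is what
  remains of J_a after the factor (x/2)^a is split off and t = x^2/4 is substituted, so the theory
  of power series applies to it.\<close>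

definition bessel_core :: "real \<Rightarrow> real \<Rightarrow> real" where
  "bessel_core a t = (\<Sum>m. bessel_coeff a m * t ^ m)"

lemma rGamma_shift_real: "rGamma (z::real) = z * rGamma (z + 1)"
  by (simp add: rGamma_plus1)

text \<open>Consecutive terms have ratio |t| / ((m+1)(m+a+1)) in absolute value. The factor m+1 is
  discarded, and m+a+1 > m >= 2|t| gives at most 1/2.\<close>

lemma summable_bessel_core:
  assumes "a > -1"
  shows "summable (\<lambda>m. bessel_coeff a m * t ^ m)"
proof (rule summable_ratio_test[where c = "1/2" and N = "nat \<lceil>2 * \<bar>t\<bar>\<rceil> + 1"])
  fix m assume m: "nat \<lceil>2 * \<bar>t\<bar>\<rceil> + 1 \<le> m"
  then have mt: "2 * \<bar>t\<bar> \<le> real m" by linarith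
  have eq: "rGamma (real m + a + 1) = (real m + a + 1) * rGamma (real (Suc m) + a + 1)"
    using rGamma_shift_real[of "real m + a + 1"] by (simp add: algebra_simps)
  define G where "G = \<bar>rGamma (real (Suc m) + a + 1)\<bar>"
  have G0: "G \<ge> 0" by (simp add: G_def)
  have l: "norm (bessel_coeff a (Suc m) * t ^ Suc m) = G * \<bar>t\<bar> * (\<bar>t\<bar> ^ m / fact m) / (1 + real m)"
    by (simp add: bessel_coeff_def abs_mult power_abs G_def field_simps)
  have r: "norm (bessel_coeff a m * t ^ m) = (real m + a + 1) * G * (\<bar>t\<bar> ^ m / fact m)"
    using assms by (simp add: bessel_coeff_def abs_mult power_abs eq G_def)
  have "\<bar>t\<bar> / (1 + real m) \<le> 1/2 * (real m + a + 1)"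
  proof -
    have "\<bar>t\<bar> / (1 + real m) \<le> \<bar>t\<bar> / 1" by (rule divide_left_mono) auto
    also have "\<dots> \<le> 1/2 * (real m + a + 1)" using mt assms by simp
    finally show ?thesis .
  qed
  then have "\<bar>t\<bar> / (1 + real m) * (G * (\<bar>t\<bar> ^ m / fact m)) \<le> 1/2 * (real m + a + 1) * (G * (\<bar>t\<bar> ^ m / fact m))"
    using G0 by (intro mult_right_mono) auto
  then show "norm (bessel_coeff a (Suc m) * t ^ Suc m) \<le> 1/2 * norm (bessel_coeff a m * t ^ m)"
    unfolding l r by (simp add: mult_ac)
qed simp

text \<open>The factor \<open>Suc m\<close> cancels against the factorial, and inside
  \<open>rGamma\<close> the index shift acts as an order shift. Hence differentiating the core
  raises its order by one and changes the sign.\<close>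

lemma diffs_bessel_coeff: "diffs (bessel_coeff a) m = - bessel_coeff (a + 1) m"
proof -
  have "real (Suc m) / fact (Suc m) = 1 / fact m"
    by (simp add: divide_simps)
  then have "diffs (bessel_coeff a) m = (-1) ^ Suc m * rGamma (real (Suc m) + a + 1) * (1 / fact m)"
    unfolding diffs_def bessel_coeff_def by (metis mult.commute times_divide_eq_left times_divide_eq_right)
  then show ?thesis
    by (simp add: bessel_coeff_def add_ac)
qed

lemma has_derivative_bessel_core:
  assumes "a > -1"
  shows "(bessel_core a has_real_derivative - bessel_core (a + 1) t) (at t)"
proof -
  have "((\<lambda>x. \<Sum>m. bessel_coeff a m * x ^ m) has_real_derivative
          (\<Sum>m. diffs (bessel_coeff a) m * t ^ m)) (at t)"
    by (rule termdiffs_strong_converges_everywhere) (rule summable_bessel_core[OF assms])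
  moreover have "(\<Sum>m. diffs (bessel_coeff a) m * t ^ m) = - bessel_core (a + 1) t"
    using suminf_minus[OF summable_bessel_core[of "a + 1" t]] assms
    by (simp add: diffs_bessel_coeff bessel_core_def)
  ultimately show ?thesis by (simp add: bessel_core_def[abs_def])
qed

text \<open>Shifting the argument of \<open>rGamma\<close> splits the coefficient of order a into
  (a+1) + m times that of order a+1; the part with m sums to t times the derivative of the core of
  order a+1. For J this is the three-term recurrence J_a + J_{a+2} = (2(a+1)/x) J_{a+1}.\<close>

lemma bessel_core_recurrence:
  assumes "a > -1"
  shows "bessel_core a t = (a + 1) * bessel_core (a + 1) t - t * bessel_core (a + 2) t"
proof -
  let ?c = "bessel_coeff (a + 1)"
  have s1: "summable (\<lambda>m. ?c m * t ^ m)"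
    using assms by (intro summable_bessel_core) simp
  have s2: "summable (\<lambda>m. bessel_coeff (a + 2) m * t ^ m)"
    using assms by (intro summable_bessel_core) simp
  have "(\<lambda>m. real (Suc m) * ?c (Suc m) * t ^ Suc m) sums (- t * bessel_core (a + 2) t)"
  proof -
    have "(\<lambda>m. - t * (bessel_coeff (a + 2) m * t ^ m)) sums (- t * bessel_core (a + 2) t)"
      unfolding bessel_core_def by (intro sums_mult summable_sums s2)
    moreover have "real (Suc m) * ?c (Suc m) * t ^ Suc m = - t * (bessel_coeff (a + 2) m * t ^ m)" for m
      using diffs_bessel_coeff[of "a + 1" m] by (simp add: diffs_def add.assoc del: of_nat_Suc)
    ultimately show ?thesis by simp
  qed
  \<comment> \<open>The term with m = 0 vanishes, so undoing the index shift leaves the sum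
    unchanged.\<close>
  then have "(\<lambda>m. real m * ?c m * t ^ m) sums (- t * bessel_core (a + 2) t)"
    by (subst (asm) sums_Suc_iff) simp
  then have "(\<lambda>m. (a + 1) * (?c m * t ^ m) + real m * ?c m * t ^ m) sums
      ((a + 1) * bessel_core (a + 1) t + (- t * bessel_core (a + 2) t))"
    unfolding bessel_core_def by (intro sums_add sums_mult summable_sums s1)
  moreover have "(a + 1) * (?c m * t ^ m) + real m * ?c m * t ^ m = bessel_coeff a m * t ^ m" for m
    using rGamma_shift_real[of "real m + a + 1"]
    by (simp add: bessel_coeff_def field_simps)
  ultimately show ?thesis
    by (simp add: bessel_core_def sums_iff)
qed

section \<open>The planar linear system satisfied by J_a and J_{a+1}\<close>

lemma bessel_J_eq_core:
  assumes "x > 0" "a > -1"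
  shows "bessel_J a x = (x / 2) powr a * bessel_core a (x\<^sup>2 / 4)"
proof -
  have "(x / 2) powr (2 * real m + a) = (x / 2) powr a * (x\<^sup>2 / 4) ^ m" for m
  proof -
    have "(x / 2) powr (2 * real m) = (x / 2) ^ (2 * m)"
      using assms powr_realpow[of "x / 2" "2 * m"] by simp
    then show ?thesis by (simp add: powr_add power_mult power_divide)
  qed
  then have "bessel_J a x = (\<Sum>m. (x / 2) powr a * (bessel_coeff a m * (x\<^sup>2 / 4) ^ m))"
    by (simp add: bessel_J_def bessel_coeff_def mult_ac)
  also have "\<dots> = (x / 2) powr a * bessel_core a (x\<^sup>2 / 4)"
    unfolding bessel_core_def by (intro suminf_mult summable_bessel_core assms)
  finally show ?thesis .
qed

lemma bessel_J_Suc_eq_core: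
  assumes "x > 0" "a > -1"
  shows "bessel_J (a + 1) x = (x / 2) powr a * (x / 2) * bessel_core (a + 1) (x\<^sup>2 / 4)"
  using assms by (simp add: bessel_J_eq_core powr_add)

lemma has_derivative_bessel_J:
  assumes "x > 0" "a > -1"
  shows "(bessel_J a has_real_derivative a / x * bessel_J a x - bessel_J (a + 1) x) (at x)"
proof -
  have core: "((\<lambda>x. bessel_core a (x\<^sup>2 / 4)) has_real_derivative - bessel_core (a + 1) (x\<^sup>2 / 4) * (x / 2)) (at x)"
    by (rule DERIV_chain2[OF has_derivative_bessel_core]) (use assms in \<open>auto intro!: derivative_eq_intros\<close>)
  have pw: "((\<lambda>x. (x / 2) powr a) has_real_derivative a / x * (x / 2) powr a) (at x)"
    using assms by (auto intro!: derivative_eq_intros simp: powr_diff field_simps)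
  have "((\<lambda>x. (x / 2) powr a * bessel_core a (x\<^sup>2 / 4)) has_real_derivative
          a / x * bessel_J a x - bessel_J (a + 1) x) (at x)"
    by (rule DERIV_cong[OF DERIV_mult[OF pw core]])
       (use assms in \<open>simp only: bessel_J_eq_core[of x a] bessel_J_Suc_eq_core, simp add: mult_ac\<close>)
  then show ?thesis
    by (rule has_field_derivative_transform_within_open[of _ _ _ "{0<..}"])
       (use assms in \<open>auto simp: bessel_J_eq_core\<close>)
qed

text \<open>The derivative rule at order a+1 brings in J_{a+2}; the three-term recurrence eliminates
  it, which closes the system in J_a and J_{a+1}.\<close>

lemma has_derivative_bessel_J_Suc:
  assumes "x > 0" "a > -1"
  shows "(bessel_J (a + 1) has_real_derivative
           bessel_J a x - (a + 1) / x * bessel_J (a + 1) x) (at x)"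
proof -
  have J2: "bessel_J (a + 2) x = (x / 2) powr a * (x\<^sup>2 / 4) * bessel_core (a + 2) (x\<^sup>2 / 4)"
    using assms bessel_J_eq_core[of x "a + 2"]
    by (simp add: powr_add powr_numeral power2_eq_square)
  have "bessel_J a x = (x / 2) powr a *
      ((a + 1) * bessel_core (a + 1) (x\<^sup>2 / 4) - x\<^sup>2 / 4 * bessel_core (a + 2) (x\<^sup>2 / 4))"
    using assms bessel_core_recurrence[of a "x\<^sup>2 / 4"] by (simp only: bessel_J_eq_core)
  also have "\<dots> = 2 * (a + 1) / x * bessel_J (a + 1) x - bessel_J (a + 2) x"
    unfolding J2 bessel_J_Suc_eq_core[OF assms] using assms by (simp add: right_diff_distrib mult_ac)
  finally have "bessel_J a x = 2 * (a + 1) / x * bessel_J (a + 1) x - bessel_J (a + 2) x" .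
  then have "(a + 1) / x * bessel_J (a + 1) x - bessel_J (a + 2) x =
      bessel_J a x - (a + 1) / x * bessel_J (a + 1) x"
    by (simp add: field_simps)
  moreover have "(bessel_J (a + 1) has_real_derivative
      (a + 1) / x * bessel_J (a + 1) x - bessel_J (a + 2) x) (at x)"
    using has_derivative_bessel_J[of x "a + 1"] assms by (simp add: add.assoc)
  ultimately show ?thesis by (simp only:)
qed

section \<open>Behaviour at the origin\<close>

lemma bessel_core_0:
  assumes "a > -1" shows "bessel_core a 0 \<noteq> 0"
proof -
  have "bessel_core a 0 = rGamma (a + 1)"
    unfolding bessel_core_def by (subst powser_zero) (simp add: bessel_coeff_def)
  then show ?thesis using assms
    by (auto simp: rGamma_eq_zero_iff elim!: nonpos_Ints_cases)
qed

lemma isCont_bessel_core: "a > -1 \<Longrightarrow> isCont (bessel_core a) t"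
  using has_derivative_bessel_core DERIV_isCont by blast

text \<open>Removing the positive factor (x/2)^a, or (x/2)^(a+1) if c = 0, leaves a function
  continuous at 0 with nonzero value there. This starts the positivity proof for the modulus and
  keeps zeros from accumulating at 0.\<close>

lemma bessel_comb_nonzero_near_0:
  fixes a c d :: real
  assumes "a > -1" "\<not> (c = 0 \<and> d = 0)"
  shows "\<exists>e>0. \<forall>x. 0 < x \<and> x < e \<longrightarrow> c * bessel_J a x + d * bessel_J (a + 1) x \<noteq> 0"
proof -
  have near: "\<exists>e>0. \<forall>x. 0 < x \<and> x < e \<longrightarrow> f x \<noteq> 0" if "isCont f 0" "f 0 \<noteq> 0" for f :: "real \<Rightarrow> real"
  proof -
    have "\<forall>\<^sub>F x in at 0. f x \<noteq> 0"
      using that by (intro tendsto_imp_eventually_ne) (auto simp: isCont_def)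
    then show ?thesis by (force simp: eventually_at dist_real_def)
  qed
  have C: "isCont (\<lambda>x. bessel_core b (x\<^sup>2 / 4)) 0" if "b > -1" for b
    by (rule isCont_o2[of _ "\<lambda>x. x\<^sup>2 / 4"]) (auto intro!: continuous_intros isCont_bessel_core that)
  show ?thesis
  proof (cases "c = 0")
    case True
    with assms have "d \<noteq> 0" by simp
    obtain e where "e > 0" "\<And>x. 0 < x \<Longrightarrow> x < e \<Longrightarrow> bessel_core (a + 1) (x\<^sup>2 / 4) \<noteq> 0"
      using near[OF C[of "a + 1"]] bessel_core_0[of "a + 1"] assms by auto
    then show ?thesis
      using True \<open>d \<noteq> 0\<close> assms by (intro exI[of _ e]) (auto simp: bessel_J_Suc_eq_core)
  next
    case False
    let ?f = "\<lambda>x. c * bessel_core a (x\<^sup>2 / 4) + d * (x / 2) * bessel_core (a + 1) (x\<^sup>2 / 4)"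
    have "isCont ?f 0" using assms by (intro continuous_intros C) auto
    moreover have "?f 0 \<noteq> 0" using False bessel_core_0 assms by simp
    ultimately obtain e where e: "e > 0" "\<And>x. 0 < x \<Longrightarrow> x < e \<Longrightarrow> ?f x \<noteq> 0"
      using near by blast
    have "c * bessel_J a x + d * bessel_J (a + 1) x = (x / 2) powr a * ?f x" if "x > 0" for x
      unfolding bessel_J_Suc_eq_core[OF that assms(1)] bessel_J_eq_core[OF that assms(1)]
      by (simp add: algebra_simps)
    then show ?thesis using e by (intro exI[of _ e]) auto
  qed
qed

subsection \<open>The phase\<close>

definition bessel_modulus2 :: "real \<Rightarrow> real \<Rightarrow> real" where
  "bessel_modulus2 a x = (bessel_J a x)\<^sup>2 + (bessel_J (a + 1) x)\<^sup>2"

text \<open>By the recurrences this is the angular velocity (u v' - v u') / (u^2 + v^2) of (u, v) =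
  (J_a, J_{a+1}), given explicitly before any angle has been constructed.\<close>

definition bessel_phase_deriv :: "real \<Rightarrow> real \<Rightarrow> real" where
  "bessel_phase_deriv a x =
     1 - (2 * a + 1) / x * (bessel_J a x * bessel_J (a + 1) x / bessel_modulus2 a x)"

lemma has_derivative_bessel_modulus2:
  assumes "x > 0" "a > -1"
  shows "(bessel_modulus2 a has_real_derivative
           2 * (a * (bessel_J a x)\<^sup>2 - (a + 1) * (bessel_J (a + 1) x)\<^sup>2) / x) (at x)"
  unfolding bessel_modulus2_def[abs_def]
  by (rule DERIV_cong[OF DERIV_add[OF
        DERIV_power[OF has_derivative_bessel_J[OF assms], of 2]
        DERIV_power[OF has_derivative_bessel_J_Suc[OF assms], of 2]]])
     (use assms in \<open>simp add: field_simps power2_eq_square\<close>)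

text \<open>
  The logarithmic derivative of the squared modulus is at least \<open>-K / x\<close>, so its product with
  \<open>x powr K\<close> is nondecreasing; it is positive near \<open>0\<close>.
\<close>

lemma bessel_modulus2_pos:
  assumes "x > 0" "a > -1"
  shows "bessel_modulus2 a x > 0"
proof -
  obtain e where e: "e > 0" "\<And>y. 0 < y \<Longrightarrow> y < e \<Longrightarrow> bessel_J a y \<noteq> 0"
    using bessel_comb_nonzero_near_0[of a 1 0] assms by auto
  define y where "y = min x (e / 2)"
  have y: "0 < y" "y \<le> x" "y < e" using e assms by (auto simp: y_def)
  \<comment> \<open>With this K both \<open>K + 2 * a\<close> and \<open>K - 2 * (a + 1)\<close> are
    nonnegative whatever the sign of a.\<close>
  define K where "K = 2 * (\<bar>a\<bar> + 1)"
  have "y powr K * bessel_modulus2 a y \<le> x powr K * bessel_modulus2 a x"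
  proof (rule DERIV_nonneg_imp_nondecreasing[OF y(2)])
    fix z assume z: "y \<le> z" "z \<le> x"
    with y have z0: "z > 0" by simp
    let ?u = "bessel_J a z" and ?v = "bessel_J (a + 1) z"
    have p: "((\<lambda>z. z powr K) has_real_derivative K / z * z powr K) (at z)"
      using z0 by (auto intro!: derivative_eq_intros simp: powr_diff)
    have "((\<lambda>z. z powr K * bessel_modulus2 a z) has_real_derivative
       z powr K / z * ((K + 2 * a) * ?u\<^sup>2 + (K - 2 * (a + 1)) * ?v\<^sup>2)) (at z)"
      by (rule DERIV_cong[OF DERIV_mult[OF p has_derivative_bessel_modulus2[OF z0 assms(2)]]])
         (use z0 in \<open>simp add: bessel_modulus2_def field_simps\<close>)
    moreover have "z powr K / z * ((K + 2 * a) * ?u\<^sup>2 + (K - 2 * (a + 1)) * ?v\<^sup>2) \<ge> 0"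
    proof -
      have "K + 2 * a \<ge> 0" "K - 2 * (a + 1) \<ge> 0" using abs_ge_self[of a] abs_ge_minus_self[of a] by (simp_all add: K_def)
      then have "(K + 2 * a) * ?u\<^sup>2 \<ge> 0" "(K - 2 * (a + 1)) * ?v\<^sup>2 \<ge> 0"
        by (simp_all only: mult_nonneg_nonneg zero_le_power2)
      then show ?thesis using z0 by (intro mult_nonneg_nonneg[OF _ add_nonneg_nonneg]) simp_all
    qed
    ultimately show "\<exists>D. ((\<lambda>z. z powr K * bessel_modulus2 a z) has_real_derivative D) (at z) \<and> 0 \<le> D"
      by blast
  qed
  moreover have "y powr K * bessel_modulus2 a y > 0"
    using y e(2)[of y] by (auto simp: bessel_modulus2_def intro!: mult_pos_pos add_pos_nonneg)
  ultimately have "x powr K * bessel_modulus2 a x > 0" by linarith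
  then show ?thesis using assms by (simp add: zero_less_mult_iff)
qed

text \<open>In terms of the angle, u v / (u^2 + v^2) is sin(2\<theta>)/2, with derivative
  cos(2\<theta>) \<theta>', and cos(2\<theta>) = (u^2 - v^2) / (u^2 + v^2). The form chosen shows
  that only 1/x survives where the angular velocity vanishes; the lemma also yields the continuity
  needed to integrate it.\<close>

lemma has_derivative_bessel_phase_deriv:
  assumes "x > 0" "a > -1"
  shows "(bessel_phase_deriv a has_real_derivative
           (1 - bessel_phase_deriv a x) / x
           - (2 * a + 1) / x * (((bessel_J a x)\<^sup>2 - (bessel_J (a + 1) x)\<^sup>2)
               / bessel_modulus2 a x * bessel_phase_deriv a x)) (at x)"
proof -
  let ?u = "bessel_J a x" and ?v = "bessel_J (a + 1) x" and ?m = "bessel_modulus2 a x"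
  have m: "?m > 0" using bessel_modulus2_pos[OF assms] .
  have uv: "((\<lambda>x. bessel_J a x * bessel_J (a + 1) x) has_real_derivative ?u\<^sup>2 - ?v\<^sup>2 - ?u * ?v / x) (at x)"
    by (rule DERIV_cong[OF DERIV_mult[OF has_derivative_bessel_J[OF assms] has_derivative_bessel_J_Suc[OF assms]]])
       (use assms in \<open>simp add: field_simps power2_eq_square\<close>)
  have key: "(?u\<^sup>2 - ?v\<^sup>2 - ?u * ?v / x) * ?m - ?u * ?v * (2 * (a * ?u\<^sup>2 - (a + 1) * ?v\<^sup>2) / x)
     = (?u\<^sup>2 - ?v\<^sup>2) * (?m - (2 * a + 1) / x * (?u * ?v))"
    using assms by (simp add: bessel_modulus2_def field_simps power2_eq_square)
  have pd: "?m - (2 * a + 1) / x * (?u * ?v) = ?m * bessel_phase_deriv a x"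
    using m by (simp add: bessel_phase_deriv_def right_diff_distrib)
  have q: "((\<lambda>x. bessel_J a x * bessel_J (a + 1) x / bessel_modulus2 a x) has_real_derivative
      (?u\<^sup>2 - ?v\<^sup>2) / ?m * bessel_phase_deriv a x) (at x)"
    by (rule DERIV_cong[OF DERIV_divide[OF uv has_derivative_bessel_modulus2[OF assms]]])
       (use m in \<open>simp_all only: key pd, simp_all\<close>)
  have i: "((\<lambda>x. (2 * a + 1) / x) has_real_derivative - ((2 * a + 1) / x) / x) (at x)"
    using assms by (auto intro!: derivative_eq_intros simp: field_simps)
  show ?thesis
    unfolding bessel_phase_deriv_def[abs_def]
    by (rule DERIV_cong[OF DERIV_diff[OF DERIV_const DERIV_mult[OF i q]]])
       (use assms in \<open>simp add: bessel_phase_deriv_def field_simps\<close>)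
qed

lemma bessel_phase_deriv_bound:
  assumes "x > 0" "a > -1"
  shows "\<bar>bessel_phase_deriv a x - 1\<bar> \<le> \<bar>2 * a + 1\<bar> / x"
proof -
  let ?u = "bessel_J a x" and ?v = "bessel_J (a + 1) x"
  have m: "bessel_modulus2 a x > 0" using bessel_modulus2_pos[OF assms] .
  have "\<bar>?u * ?v\<bar> \<le> bessel_modulus2 a x"
    using sum_squares_bound[of "\<bar>?u\<bar>" "\<bar>?v\<bar>"] abs_ge_zero[of "?u * ?v"]
    unfolding bessel_modulus2_def abs_mult power2_abs by linarith
  then have "\<bar>?u * ?v / bessel_modulus2 a x\<bar> \<le> 1" using m by (simp add: abs_divide)
  then have "\<bar>2 * a + 1\<bar> / x * \<bar>?u * ?v / bessel_modulus2 a x\<bar> \<le> \<bar>2 * a + 1\<bar> / x * 1"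
    using assms by (intro mult_left_mono) auto
  then show ?thesis
    using assms by (simp add: bessel_phase_deriv_def abs_mult abs_divide)
qed

text \<open>Normalising removes the radial part of the velocity, so the unit vector turns with the
  angular velocity exactly as (cos, sin) of an angle does.\<close>

lemma has_derivative_bessel_direction:
  assumes "x > 0" "a > -1"
  shows "((\<lambda>x. bessel_J a x / sqrt (bessel_modulus2 a x)) has_real_derivative
            - bessel_phase_deriv a x * (bessel_J (a + 1) x / sqrt (bessel_modulus2 a x))) (at x)"
    and "((\<lambda>x. bessel_J (a + 1) x / sqrt (bessel_modulus2 a x)) has_real_derivative
            bessel_phase_deriv a x * (bessel_J a x / sqrt (bessel_modulus2 a x))) (at x)"
proof -
  let ?u = "bessel_J a x" and ?v = "bessel_J (a + 1) x" and ?m = "bessel_modulus2 a x"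
  define u' where "u' = a / x * ?u - ?v"
  define v' where "v' = ?u - (a + 1) / x * ?v"
  define s where "s = sqrt ?m"
  have m: "?m > 0" using bessel_modulus2_pos[OF assms] .
  have s: "s > 0" "?m = s * s" using m by (simp_all add: s_def)
  have muv: "?u * ?u + ?v * ?v = s * s"
    unfolding s(2)[symmetric] by (simp add: bessel_modulus2_def power2_eq_square)
  have pd: "?u * v' - ?v * u' = s * s * bessel_phase_deriv a x"
    using m assms unfolding s(2)[symmetric]
    by (simp add: bessel_phase_deriv_def u'_def v'_def right_diff_distrib)
       (simp add: bessel_modulus2_def field_simps power2_eq_square)
  have u: "(bessel_J a has_real_derivative u') (at x)"
    unfolding u'_def by (rule has_derivative_bessel_J[OF assms])
  have v: "(bessel_J (a + 1) has_real_derivative v') (at x)"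
    unfolding v'_def by (rule has_derivative_bessel_J_Suc[OF assms])
  have "(bessel_modulus2 a has_real_derivative 2 * (?u * u' + ?v * v')) (at x)"
    unfolding bessel_modulus2_def[abs_def]
    by (rule DERIV_cong[OF DERIV_add[OF DERIV_power[OF u, of 2] DERIV_power[OF v, of 2]]]) simp
  then have ds: "((\<lambda>x. sqrt (bessel_modulus2 a x)) has_real_derivative (?u * u' + ?v * v') / s) (at x)"
    by (rule DERIV_cong[OF DERIV_chain2[where f = sqrt and g = "bessel_modulus2 a", OF DERIV_real_sqrt[OF m]]])
       (unfold s_def[symmetric], use s(1) in \<open>simp add: field_simps\<close>)
  have s0: "sqrt ?m \<noteq> 0" using s(1) by (simp add: s_def)
  \<comment> \<open>Subtracting from (u', v') its component along (u, v) leaves a multiple of (-v,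
    u), whose coefficient is the cross product computed in \<open>pd\<close>; \<open>ev\<close> is
    the other coordinate.\<close>
  have eu: "u' * (s * s) - ?u * (?u * u' + ?v * v') = - ?v * (s * s * bessel_phase_deriv a x)"
  proof -
    have "u' * (?u * ?u + ?v * ?v) - ?u * (?u * u' + ?v * v') = - ?v * (?u * v' - ?v * u')"
      by (simp add: algebra_simps)
    then show ?thesis unfolding muv pd .
  qed
  have ev: "v' * (s * s) - ?v * (?u * u' + ?v * v') = ?u * (s * s * bessel_phase_deriv a x)"
  proof -
    have "v' * (?u * ?u + ?v * ?v) - ?v * (?u * u' + ?v * v') = ?u * (?u * v' - ?v * u')"
      by (simp add: algebra_simps)
    then show ?thesis unfolding muv pd .
  qed
  have q: "(p * s - q * (r / s)) / (s * s) = (p * (s * s) - q * r) / (s * s * s)" for p q r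
    using s(1) by (simp add: field_simps)
  show "((\<lambda>x. bessel_J a x / sqrt (bessel_modulus2 a x)) has_real_derivative
            - bessel_phase_deriv a x * (?v / sqrt ?m)) (at x)"
    by (rule DERIV_cong[OF DERIV_divide[OF u ds s0]])
       (unfold s_def[symmetric] q eu, use s(1) in \<open>simp add: field_simps\<close>)
  show "((\<lambda>x. bessel_J (a + 1) x / sqrt (bessel_modulus2 a x)) has_real_derivative
            bessel_phase_deriv a x * (?u / sqrt ?m)) (at x)"
    by (rule DERIV_cong[OF DERIV_divide[OF v ds s0]])
       (unfold s_def[symmetric] q ev, use s(1) in \<open>simp add: field_simps\<close>)
qed

text \<open>No lifting of the curve to an angle is needed: integrate the angular velocity to \<phi>,
  turn the unit vector back by \<phi>, and the resulting vector (A, B) is constant. The normalised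
  combination is then a fixed sinusoid in \<phi>.\<close>

lemma bessel_comb_phase:
  fixes a c d :: real
  assumes a: "a > -1" and cd: "\<not> (c = 0 \<and> d = 0)"
  obtains \<theta> where "\<And>x. x > 0 \<Longrightarrow> (\<theta> has_real_derivative bessel_phase_deriv a x) (at x)"
    and "\<And>x. x > 0 \<Longrightarrow> c * bessel_J a x + d * bessel_J (a + 1) x = 0 \<longleftrightarrow> sin (\<theta> x) = 0"
proof -
  have "\<exists>F. \<forall>x. 0 < ereal x \<longrightarrow> ereal x < \<infinity> \<longrightarrow> (F has_vector_derivative bessel_phase_deriv a x) (at x)"
    by (rule einterval_antiderivative)
       (use has_derivative_bessel_phase_deriv[OF _ a] DERIV_isCont in \<open>auto simp: zero_ereal_def\<close>)
  then obtain \<phi> where \<phi>: "\<And>x. x > 0 \<Longrightarrow> (\<phi> has_real_derivative bessel_phase_deriv a x) (at x)"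
    by (auto simp: has_real_derivative_iff_has_vector_derivative)
  define e1 where "e1 = (\<lambda>x. bessel_J a x / sqrt (bessel_modulus2 a x))"
  define e2 where "e2 = (\<lambda>x. bessel_J (a + 1) x / sqrt (bessel_modulus2 a x))"
  have e1: "(e1 has_real_derivative - bessel_phase_deriv a x * e2 x) (at x)"
    and e2: "(e2 has_real_derivative bessel_phase_deriv a x * e1 x) (at x)" if "x > 0" for x
    using has_derivative_bessel_direction[OF that a] by (simp_all add: e1_def e2_def)
  have e12: "(e1 x)\<^sup>2 + (e2 x)\<^sup>2 = 1" if "x > 0" for x
    using bessel_modulus2_pos[OF that a]
    by (simp add: e1_def e2_def power_divide add_divide_distrib[symmetric])
       (simp add: bessel_modulus2_def)
  define A where "A = (\<lambda>x. e1 x * cos (\<phi> x) + e2 x * sin (\<phi> x))"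
  define B where "B = (\<lambda>x. e2 x * cos (\<phi> x) - e1 x * sin (\<phi> x))"
  have dA: "(A has_real_derivative 0) (at x)" if "x > 0" for x
    unfolding A_def by (auto intro!: derivative_eq_intros e1 e2 \<phi> that simp: algebra_simps)
  have dB: "(B has_real_derivative 0) (at x)" if "x > 0" for x
    unfolding B_def by (auto intro!: derivative_eq_intros e1 e2 \<phi> that simp: algebra_simps)
  have const: "f x = f 1" if "\<And>x. x > 0 \<Longrightarrow> (f has_real_derivative 0) (at x)" "x > 0"
    for f :: "real \<Rightarrow> real" and x
  proof -
    have "\<exists>k. \<forall>x\<in>{0<..}. f x = k"
      by (rule has_field_derivative_zero_constant)
         (auto intro: has_field_derivative_at_within that(1))
    then show ?thesis using that(2) by auto
  qed
  have A: "A x = A 1" and B: "B x = B 1" if "x > 0" for x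
    using const dA dB that by blast+
  \<comment> \<open>P and Q are the coefficients of cos \<phi> and sin \<phi> in
    \<open>c * e1 + d * e2\<close>; below they are put in amplitude-phase form with amplitude R and
    shift \<delta>.\<close>
  define P where "P = c * A 1 + d * B 1"
  define Q where "Q = d * A 1 - c * B 1"
  have "(A 1)\<^sup>2 + (B 1)\<^sup>2 = ((e1 1)\<^sup>2 + (e2 1)\<^sup>2) * ((sin (\<phi> 1))\<^sup>2 + (cos (\<phi> 1))\<^sup>2)"
    unfolding A_def B_def by algebra
  then have AB: "(A 1)\<^sup>2 + (B 1)\<^sup>2 = 1" by (simp add: e12)
  have "P\<^sup>2 + Q\<^sup>2 = (c\<^sup>2 + d\<^sup>2) * ((A 1)\<^sup>2 + (B 1)\<^sup>2)"
    unfolding P_def Q_def by algebra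
  then have PQ: "P\<^sup>2 + Q\<^sup>2 > 0"
    using cd by (simp add: AB sum_power2_gt_zero_iff)
  define R where "R = sqrt (P\<^sup>2 + Q\<^sup>2)"
  have R: "R > 0" "R\<^sup>2 = P\<^sup>2 + Q\<^sup>2" using PQ by (simp_all add: R_def)
  have "(Q / R)\<^sup>2 + (P / R)\<^sup>2 = 1"
    unfolding power_divide add_divide_distrib[symmetric] R(2) add.commute[of "Q\<^sup>2"]
    by (rule divide_self) (use PQ in linarith)
  then obtain \<delta> where \<delta>: "Q / R = cos \<delta>" "P / R = sin \<delta>"
    using sincos_total_2pi by metis
  have PQR: "P = R * sin \<delta>" "Q = R * cos \<delta>" using \<delta> R by (simp_all add: field_simps)
  show ?thesis
  proof
    fix x :: real assume x: "x > 0"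
    show "((\<lambda>x. \<phi> x + \<delta>) has_real_derivative bessel_phase_deriv a x) (at x)"
      using \<phi>[OF x] by (auto intro!: derivative_eq_intros)
    have "c * e1 x + d * e2 x = (c * e1 x + d * e2 x) * ((sin (\<phi> x))\<^sup>2 + (cos (\<phi> x))\<^sup>2)"
      by simp
    also have "\<dots> = (c * A x + d * B x) * cos (\<phi> x) + (d * A x - c * B x) * sin (\<phi> x)"
      unfolding A_def B_def by algebra
    also have "\<dots> = R * sin (\<phi> x + \<delta>)"
      unfolding A[OF x] B[OF x] P_def[symmetric] Q_def[symmetric]
      by (simp add: PQR sin_add algebra_simps)
    finally have "c * e1 x + d * e2 x = R * sin (\<phi> x + \<delta>)" .
    moreover have "c * bessel_J a x + d * bessel_J (a + 1) x =
        sqrt (bessel_modulus2 a x) * (c * e1 x + d * e2 x)"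
      using bessel_modulus2_pos[OF x a] by (simp add: e1_def e2_def field_simps)
    ultimately show "c * bessel_J a x + d * bessel_J (a + 1) x = 0 \<longleftrightarrow> sin (\<phi> x + \<delta>) = 0"
      using bessel_modulus2_pos[OF x a] R by simp
  qed
qed

lemma tendsto_bessel_phase_deriv:
  assumes "a > -1"
  shows "(bessel_phase_deriv a \<longlongrightarrow> 1) at_top"
proof -
  have "((\<lambda>x. \<bar>2 * a + 1\<bar> / x) \<longlongrightarrow> 0) at_top"
    by (rule tendsto_divide_0[OF tendsto_const])
       (rule filterlim_mono[OF filterlim_ident at_top_le_at_infinity order_refl])
  then have "((\<lambda>x. bessel_phase_deriv a x - 1) \<longlongrightarrow> 0) at_top"
    by (rule Lim_null_comparison[rotated])
       (rule eventually_mono[OF eventually_gt_at_top[of 0]],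
        use bessel_phase_deriv_bound[OF _ assms] in simp)
  then show ?thesis by (rule LIM_zero_cancel)
qed

subsection \<open>Discreteness of the zeros\<close>

lemma isolated_value_if_deriv_nonzero:
  fixes f :: "real \<Rightarrow> real"
  assumes "(f has_real_derivative D) (at x)" "D \<noteq> 0"
  shows "\<forall>\<^sub>F y in at x. f y \<noteq> f x"
proof -
  have "((\<lambda>y. (f y - f x) / (y - x)) \<longlongrightarrow> D) (at x)"
    using assms(1) by (simp add: has_field_derivative_iff)
  from tendsto_imp_eventually_ne[OF this assms(2)] show ?thesis
    by (rule eventually_mono) auto
qed

text \<open>Near x the derivative vanishes only at x itself, whereas a repeated value f y = f x
  would force, by the mean value theorem, a zero of f' strictly between x and y.\<close>

lemma isolated_value_if_second_deriv_nonzero: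
  fixes f f' :: "real \<Rightarrow> real"
  assumes S: "open S" "x \<in> S" and f: "\<And>y. y \<in> S \<Longrightarrow> (f has_real_derivative f' y) (at y)"
    and f': "(f' has_real_derivative D) (at x)" "f' x = 0" "D \<noteq> 0"
  shows "\<forall>\<^sub>F y in at x. f y \<noteq> f x"
proof -
  have "\<forall>\<^sub>F y in at x. f' y \<noteq> 0"
    using isolated_value_if_deriv_nonzero[OF f'(1,3)] f'(2) by simp
  moreover have "\<forall>\<^sub>F y in at x. y \<in> S"
    using S by (rule eventually_at_in_open')
  ultimately have "\<forall>\<^sub>F y in at x. y \<in> S \<and> f' y \<noteq> 0"
    by eventually_elim simp
  then obtain e where e: "e > 0" "\<And>y. y \<noteq> x \<Longrightarrow> \<bar>y - x\<bar> < e \<Longrightarrow> y \<in> S \<and> f' y \<noteq> 0"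
    by (auto simp: eventually_at dist_real_def)
  have "f y \<noteq> f x" if y: "y \<noteq> x" "\<bar>y - x\<bar> < e" for y
  proof -
    have D: "(f has_real_derivative f' z) (at z)" if "min x y \<le> z" "z \<le> max x y" for z
      using f e(2)[of z] S(2) y that by (cases "z = x") (auto simp: min_def max_def split: if_splits)
    have "min x y < max x y" using y by (auto simp: min_def max_def)
    from MVT2[OF this D] obtain z where z: "min x y < z" "z < max x y"
      "f (max x y) - f (min x y) = (max x y - min x y) * f' z" by auto
    have "f' z \<noteq> 0" using e(2)[of z] z(1,2) y(2) by (auto simp: min_def max_def split: if_splits)
    then have "f (max x y) \<noteq> f (min x y)" using z \<open>min x y < max x y\<close> by auto
    then show ?thesis by (auto simp: min_def max_def split: if_splits)
  qed
  then show ?thesis using e(1) by (auto simp: eventually_at dist_real_def)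
qed

text \<open>
  Where the phase is stationary its second derivative is \<open>1 / x\<close>, so a zero of the combination
  is isolated even if it is not simple.
\<close>

lemma finite_bessel_comb_zeros:
  fixes a c d :: real
  assumes a: "a > -1" and cd: "\<not> (c = 0 \<and> d = 0)"
  shows "finite {x. 0 < x \<and> x \<le> X \<and> c * bessel_J a x + d * bessel_J (a + 1) x = 0}" (is "finite ?Z")
proof (rule ccontr)
  assume "infinite ?Z"
  moreover have "?Z \<subseteq> {0..X}" by auto
  ultimately obtain x where x: "x \<in> {0..X}" "x islimpt ?Z"
    using Heine_Borel_imp_Bolzano_Weierstrass[of "{0..X}"] by blast
  obtain \<theta> where \<theta>: "\<And>x. x > 0 \<Longrightarrow> (\<theta> has_real_derivative bessel_phase_deriv a x) (at x)"
    and zero: "\<And>x. x > 0 \<Longrightarrow> c * bessel_J a x + d * bessel_J (a + 1) x = 0 \<longleftrightarrow> sin (\<theta> x) = 0"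
    using bessel_comb_phase[OF assms] by blast
  \<comment> \<open>No point of [0, X] is an accumulation point. The origin is covered by the local
    behaviour there, points with sin(\<theta> x) nonzero by continuity, and the remaining points by
    showing that \<theta> does not repeat its value nearby.\<close>
  have "\<forall>\<^sub>F y in at x. y \<notin> ?Z"
  proof (cases "x = 0")
    case True
    then show ?thesis
      using bessel_comb_nonzero_near_0[OF assms] by (force simp: eventually_at dist_real_def)
  next
    case False
    with x have x0: "x > 0" by simp
    have pos: "\<forall>\<^sub>F y in at x. y > 0"
      using eventually_at_in_open'[of "{0<..}" x] x0 by simp
    have cont: "isCont \<theta> x" using \<theta>[OF x0] DERIV_isCont by blast
    show ?thesis
    proof (cases "sin (\<theta> x) = 0")
      case False
      have "isCont (\<lambda>y. sin (\<theta> y)) x" using cont by (intro continuous_intros)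
      then have "\<forall>\<^sub>F y in at x. sin (\<theta> y) \<noteq> 0"
        using False by (intro tendsto_imp_eventually_ne) (auto simp: isCont_def)
      with pos show ?thesis by eventually_elim (auto simp: zero)
    next
      case True
      have "\<forall>\<^sub>F y in at x. \<theta> y \<noteq> \<theta> x"
      proof (cases "bessel_phase_deriv a x = 0")
        case False
        then show ?thesis by (rule isolated_value_if_deriv_nonzero[OF \<theta>[OF x0]])
      next
        case True
        show ?thesis
          by (rule isolated_value_if_second_deriv_nonzero[of "{0<..}" x \<theta>, OF _ _ _
                has_derivative_bessel_phase_deriv[OF x0 a] True])
             (use x0 True \<theta> in auto)
      qed
      \<comment> \<open>Zeros of the sine less than pi apart coincide, so near x a zero at y would
        force \<theta> y = \<theta> x.\<close>
      moreover have "\<forall>\<^sub>F y in at x. dist (\<theta> y) (\<theta> x) < pi"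
        using cont by (intro tendstoD) (auto simp: isCont_def)
      ultimately show ?thesis using pos
      proof eventually_elim
        case (elim y)
        have "sin (\<theta> y) \<noteq> 0"
        proof
          assume "sin (\<theta> y) = 0"
          with True have "sin (\<theta> y - \<theta> x) = 0" by (simp add: sin_diff)
          then obtain i :: int where "\<theta> y - \<theta> x = of_int i * pi" by (auto simp: sin_zero_iff_int2)
          moreover from this elim have "i \<noteq> 0" by auto
          then have "1 \<le> \<bar>real_of_int i\<bar>" by linarith
          ultimately show False using elim by (simp add: dist_real_def abs_mult)
        qed
        with elim show ?case by (auto simp: zero)
      qed
    qed
  qed
  with x(2) show False
    by (auto simp: islimpt_conv_frequently_at frequently_def elim!: eventually_mono)
qed

subsection \<open>Spacing\<close>

text \<open>\<open>LEAST\<close> on the reals is informative only if the minimum is attained.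
  Cutting off at a known witness b leaves a finite nonempty set, whose \<open>Min\<close> is the
  minimum sought.\<close>

lemma LEAST_real_finite:
  fixes Z :: "real \<Rightarrow> bool"
  assumes fin: "\<And>X. finite {x. y < x \<and> x \<le> X \<and> Z x}" and ex: "\<exists>x>y. Z x"
  defines "l \<equiv> LEAST x. y < x \<and> Z x"
  shows "y < l" "Z l" "\<And>x. y < x \<Longrightarrow> Z x \<Longrightarrow> l \<le> x"
proof -
  obtain b where b: "y < b" "Z b" using ex by blast
  let ?S = "{x. y < x \<and> x \<le> b \<and> Z x}"
  have ne: "?S \<noteq> {}" and fS: "finite ?S" using b fin by auto
  have m: "y < Min ?S" "Z (Min ?S)" "Min ?S \<le> b" using Min_in[OF fS ne] by auto
  have least: "Min ?S \<le> x" if "y < x" "Z x" for x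
    using m(3) Min_le[OF fS, of x] that by (cases "x \<le> b") auto
  have "l = Min ?S" unfolding l_def by (rule Least_equality) (use m least in auto)
  then show "y < l" "Z l" "\<And>x. y < x \<Longrightarrow> Z x \<Longrightarrow> l \<le> x" using m least by auto
qed

text \<open>The phase need not be monotone near 0. Far out it increases strictly and without bound,
  so it meets every later multiple of pi exactly once and none is skipped between consecutive
  zeros.\<close>

lemma phase_zero_spacing:
  fixes \<theta> \<theta>' :: "real \<Rightarrow> real" and Z :: "real \<Rightarrow> bool" and z :: "nat \<Rightarrow> real"
  assumes z0: "z 0 = 0" and zSuc: "\<And>k. z (Suc k) = (LEAST x. z k < x \<and> Z x)"
    and zero: "\<And>x. x > 0 \<Longrightarrow> Z x \<longleftrightarrow> sin (\<theta> x) = 0"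
    and deriv: "\<And>x. x > 0 \<Longrightarrow> (\<theta> has_real_derivative \<theta>' x) (at x)"
    and lim: "(\<theta>' \<longlongrightarrow> 1) at_top"
    and fin: "\<And>X. finite {x. 0 < x \<and> x \<le> X \<and> Z x}"
  shows "(\<lambda>k. z (k + 1) - z k) \<longlonglongrightarrow> pi"
proof -
  \<comment> \<open>Any bound strictly between 0 and 1 would serve: it gives monotonicity, unbounded
    growth and nonzero denominators.\<close>
  have "\<forall>\<^sub>F x in at_top. \<theta>' x > 1/2" using lim by (rule order_tendstoD) simp
  then obtain N where N: "\<And>x. x \<ge> N \<Longrightarrow> \<theta>' x > 1/2" by (auto simp: eventually_at_top_linorder)
  define X0 where "X0 = max N 1"
  have X0: "X0 > 0" "\<And>x. x \<ge> X0 \<Longrightarrow> \<theta>' x > 1/2" using N by (auto simp: X0_def)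
  have grow: "\<theta> y + (x - y) / 2 < \<theta> x" if xy: "X0 \<le> y" "y < x" for x y
  proof -
    obtain \<xi> where \<xi>: "y < \<xi>" "\<xi> < x" "\<theta> x - \<theta> y = (x - y) * \<theta>' \<xi>"
      using MVT2[OF xy(2), of \<theta> \<theta>'] deriv X0(1) xy(1) by force
    have "(x - y) * (1/2) < (x - y) * \<theta>' \<xi>"
      using X0(2)[of \<xi>] \<xi> xy by (intro mult_strict_left_mono) auto
    with \<xi>(3) show ?thesis by linarith
  qed
  have mono: "\<theta> y < \<theta> x" if "X0 \<le> y" "y < x" for x y
    using grow[OF that] that by (simp add: field_simps)
  have hit: "\<exists>x>y. \<theta> x = T" if "X0 \<le> y" "\<theta> y < T" for y T
  proof -
    \<comment> \<open>At slope at least 1/2, a step of length 2(T - \<theta> y) suffices to reach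
      height T.\<close>
    define b where "b = y + 2 * (T - \<theta> y)"
    have "y < b" using that by (simp add: b_def)
    have "(b - y) / 2 = T - \<theta> y" by (simp add: b_def)
    then have "T \<le> \<theta> b" using grow[OF that(1) \<open>y < b\<close>] by linarith
    moreover have "isCont \<theta> x" if "y \<le> x" for x
      using deriv[of x] X0(1) \<open>X0 \<le> y\<close> that by (intro DERIV_isCont) auto
    ultimately have "\<exists>x. y \<le> x \<and> x \<le> b \<and> \<theta> x = T"
      using that \<open>y < b\<close> by (intro IVT) auto
    then show ?thesis using that by (metis less_le)
  qed
  have ex: "\<exists>x>y. Z x" for y
  proof -
    define y' where "y' = max y X0"
    \<comment> \<open>The target is the first multiple of pi strictly above the current
      phase.\<close>
    have "\<theta> y' < of_int (\<lfloor>\<theta> y' / pi\<rfloor> + 1) * pi"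
      using conjunct2[OF floor_correct[of "\<theta> y' / pi"]] by (simp only: pos_divide_less_eq[OF pi_gt_zero])
    then obtain x where x: "x > y'" "\<theta> x = of_int (\<lfloor>\<theta> y' / pi\<rfloor> + 1) * pi"
      using hit[of y'] by (auto simp: y'_def)
    have "sin (\<theta> x) = 0" unfolding x(2) sin_zero_iff_int2 by blast
    moreover have "x > 0" "x > y" using x X0(1) by (auto simp: y'_def)
    ultimately show ?thesis using zero by blast
  qed
  have finy: "finite {x. y < x \<and> x \<le> X \<and> Z x}" if "y \<ge> 0" for y X
    by (rule finite_subset[OF _ fin[of X]]) (use that in auto)
  have nonneg: "z k \<ge> 0" for k
  proof (induction k)
    case (Suc k)
    then show ?case using LEAST_real_finite(1)[OF finy[OF Suc.IH] ex] by (simp add: zSuc)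
  qed (simp add: z0)
  have inc: "z k < z (Suc k)" and ZS: "Z (z (Suc k))"
    and least: "\<And>x. z k < x \<Longrightarrow> Z x \<Longrightarrow> z (Suc k) \<le> x" for k
    unfolding zSuc using LEAST_real_finite[OF finy[OF nonneg] ex] by blast+
  have sm: "strict_mono z" using inc by (simp add: strict_mono_Suc_iff)
  have top: "filterlim z at_top sequentially"
    unfolding filterlim_at_top
  proof
    fix X :: real
    \<comment> \<open>Otherwise infinitely many distinct zeros would lie in (0, X]. The shift to
      \<open>Suc k\<close> omits the starting value \<open>z 0\<close>, which is not listed as a
      zero.\<close>
    have "\<exists>k. z (Suc k) > X"
    proof (rule ccontr)
      assume "\<not> ?thesis"
      then have "range (\<lambda>k. z (Suc k)) \<subseteq> {x. 0 < x \<and> x \<le> X \<and> Z x}"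
        using ZS order.strict_trans1[OF nonneg inc] by (auto simp: not_less)
      then have "finite (range (\<lambda>k. z (Suc k)))" using fin finite_subset by blast
      moreover have "inj (\<lambda>k. z (Suc k))"
        using strict_mono_eq[OF sm] by (simp add: inj_on_def)
      ultimately show False using finite_imageD infinite_UNIV_nat by blast
    qed
    then obtain k where "z (Suc k) > X" by blast
    then have "X \<le> z n" if "n \<ge> Suc k" for n
      using that sm by (meson less_imp_le order.trans strict_mono_less_eq)
    then show "\<forall>\<^sub>F n in sequentially. X \<le> z n"
      unfolding eventually_sequentially by blast
  qed
  have gap: "\<exists>\<xi>>z k. pi = (z (Suc k) - z k) * \<theta>' \<xi>" if k: "k \<ge> 1" "z k \<ge> X0" for k
  proof -
    have zk: "z k > 0" "z (Suc k) > 0" using k X0(1) inc[of k] by linarith+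
    have "Z (z k)" using ZS[of "k - 1"] k by simp
    then obtain i :: int where i: "\<theta> (z k) = of_int i * pi"
      using zero[OF zk(1)] by (auto simp: sin_zero_iff_int2)
    obtain j :: int where j: "\<theta> (z (Suc k)) = of_int j * pi"
      using zero[OF zk(2)] ZS[of k] by (auto simp: sin_zero_iff_int2)
    have "i < j" using mono[OF k(2) inc[of k]] by (simp add: i j)
    \<comment> \<open>This point carries the next multiple of pi; minimality of
      \<open>z (Suc k)\<close> puts the next zero no later, so the phase has advanced by exactly
      pi.\<close>
    obtain x where x: "x > z k" "\<theta> x = of_int (i + 1) * pi"
      using hit[OF k(2), of "of_int (i + 1) * pi"] by (auto simp: i)
    have "sin (\<theta> x) = 0" unfolding x(2) sin_zero_iff_int2 by blast
    then have "z (Suc k) \<le> x" using least[OF x(1)] zero[of x] x(1) zk by auto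
    then have "\<theta> (z (Suc k)) \<le> \<theta> x"
      using mono[of "z (Suc k)" x] k(2) inc[of k] by (cases "z (Suc k) = x") auto
    then have "j \<le> i + 1" unfolding j x(2) by (simp only: mult_le_cancel_right_pos pi_gt_zero of_int_le_iff)
    with \<open>i < j\<close> have "j = i + 1" by simp
    then have "\<theta> (z (Suc k)) - \<theta> (z k) = pi" by (simp add: i j algebra_simps)
    moreover obtain \<xi> where "z k < \<xi>" "\<theta> (z (Suc k)) - \<theta> (z k) = (z (Suc k) - z k) * \<theta>' \<xi>"
      using MVT2[OF inc[of k], of \<theta> \<theta>'] deriv zk(1) by force
    ultimately show ?thesis by auto
  qed
  then obtain \<xi> where \<xi>: "\<And>k. k \<ge> 1 \<Longrightarrow> z k \<ge> X0 \<Longrightarrow> \<xi> k > z k \<and> pi = (z (Suc k) - z k) * \<theta>' (\<xi> k)"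
    by metis
  have ev: "\<forall>\<^sub>F k in sequentially. k \<ge> 1 \<and> z k \<ge> X0"
    using eventually_ge_at_top[of 1] top[unfolded filterlim_at_top, rule_format, of X0]
    by eventually_elim simp
  have "filterlim \<xi> at_top sequentially"
    by (rule filterlim_at_top_mono[OF top]) (use ev \<xi> in \<open>force elim!: eventually_mono\<close>)
  \<comment> \<open>Each late gap equals pi / \<theta>'(\<xi> k), and \<xi> k tends to infinity
    together with the zeros.\<close>
  from filterlim_compose[OF lim this] have "(\<lambda>k. pi / \<theta>' (\<xi> k)) \<longlonglongrightarrow> pi / 1"
    by (intro tendsto_divide tendsto_const) auto
  moreover have "\<forall>\<^sub>F k in sequentially. pi / \<theta>' (\<xi> k) = z (k + 1) - z k"
    using ev
  proof eventually_elim
    case (elim k)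
    then have "\<theta>' (\<xi> k) > 1/2" using \<xi>[of k] X0(2)[of "\<xi> k"] by auto
    then show ?case using \<xi>[of k] elim by (simp add: field_simps)
  qed
  ultimately show ?thesis by (simp add: tendsto_cong)
qed

theorem theorem1p6:
  fixes a c d :: real
  assumes "a > -1" and "\<not> (c = 0 \<and> d = 0)"
  shows "(\<lambda>k. bessel_comb_zero a c d (k + 1) - bessel_comb_zero a c d k) \<longlonglongrightarrow> pi"
proof -
  \<comment> \<open>The gap at k = 0 is measured from the starting value 0; this single term does
    not affect the limit.\<close>
  obtain \<theta> where "\<And>x. x > 0 \<Longrightarrow> (\<theta> has_real_derivative bessel_phase_deriv a x) (at x)"
    and "\<And>x. x > 0 \<Longrightarrow> c * bessel_J a x + d * bessel_J (a + 1) x = 0 \<longleftrightarrow> sin (\<theta> x) = 0"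
    using bessel_comb_phase[OF assms] by blast
  then show ?thesis
    using tendsto_bessel_phase_deriv[OF assms(1)] finite_bessel_comb_zeros[OF assms]
    by (intro phase_zero_spacing[where \<theta> = \<theta> and \<theta>' = "bessel_phase_deriv a"
          and Z = "\<lambda>x. c * bessel_J a x + d * bessel_J (a + 1) x = 0"]) auto
qed

end
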